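(* Assume that $(Z,\mathcal{Z},\rho,R)$ is a factor of $(X,\mathcal{A},\mu,T)$. Then any homomorphism $\pi:X\to Z$ between the two systems is in fact an isomorphism.
   Context: Construction of $T$ (Chacon infinite transformation). Let $X=\mathbb{R}_+=[0,\infty)$ with its Borel $\sigma$-algebra $\mathcal{A}$ and Lebesgue measure $\mu$. Tower $0$ is the single interval $[0,1)$, of height $h_0=1$. For $n\ge0$, given tower $n$, a stack of $h_n$ disjoint intervals (called levels) of length $3^{-n}$, each closed on the left and open on the right, step $n+1$ is: cut tower $n$ vertically into three subcolumns of equal width (first, second, third from left to right); put one extra interval of length $3^{-(n+1)}$ above the second (middle) subcolumn and $3h_n+1$ extra intervals of length $3^{-(n+1)}$ above the third subcolumn (extra intervals are picked successively, each time taking the leftmost interval of the desired length in the unused part of $\mathbb{R}_+$); then stack the three subcolumns, left under right, to get tower $n+1$, of height $h_{n+1}=2(3h_n+1)$. In each tower, $T$ maps each point not in the top level to the point exactly above it. This defines $T:X\to X$, which preserves $\mu$; it is injective with image $X\setminus\{0\}$, hence invertible modulo $\mu$-null sets. A dynamical system $(Z,\mathcal{Z},\rho,R)$ here is a standard Borel space $(Z,\mathcal{Z})$ with a $\sigma$-finite measure $\rho$ and an invertible (modulo null sets) $\rho$-preserving transformation $R$. A homomorphism $\pi:X\to Z$ from $(X,\mathcal{A},\mu,T)$ to $(Z,\mathcal{Z},\rho,R)$ is a measurable map (defined $\mu$-a.e.) with $\pi\circ T=R\circ\pi$ $\mu$-a.e. and $\pi_*\mu=\rho$; $(Z,\mathcal{Z},\rho,R)$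 is a factor of $(X,\mathcal{A},\mu,T)$ if such a homomorphism exists. In particular $\rho=\pi_*\mu$ is required to be $\sigma$-finite. The homomorphism $\pi$ is an isomorphism if there is a measurable $\varphi:Z\to X$ with $\varphi\circ\pi=\mathrm{Id}$ $\mu$-a.e. and $\pi\circ\varphi=\mathrm{Id}$ $\rho$-a.e. *)

theory Defs
  imports "HOL-Analysis.Analysis"
begin

section \<open>The infinite Chacon transformation\<close>

definition leftmost_free :: "real \<Rightarrow> real set \<Rightarrow> real" where
  "leftmost_free w U = (LEAST t. 0 \<le> t \<and> {t..<t + w} \<inter> U = {})"

text \<open>Left endpoints of \<^term>\<open>k\<close> intervals of length \<^term>\<open>w\<close>, picked successively, each one
  leftmost in what remains of the half-line once \<^term>\<open>U\<close> and the earlier picks are removed.\<close>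

primrec extra_intervals :: "real \<Rightarrow> nat \<Rightarrow> real set \<Rightarrow> real list" where
  "extra_intervals w 0 U = []"
| "extra_intervals w (Suc k) U =
     (let t = leftmost_free w U in t # extra_intervals w k (U \<union> {t..<t + w}))"

definition level_width :: "nat \<Rightarrow> real" where
  "level_width n = 1 / 3 ^ n"

text \<open>A tower is represented by the list of the left endpoints of its levels, from bottom to top;
  the levels of tower \<^term>\<open>n\<close> all have length \<^term>\<open>level_width n\<close>.\<close>

primrec tower :: "nat \<Rightarrow> real list" where
  "tower 0 = [0]"
| "tower (Suc n) =
     (let L = tower n; h = length L; w = level_width (Suc n);
          U = (\<Union>a\<in>set L. {a..<a + level_width n});
          E = extra_intervals w (1 + (3 * h + 1)) U
      in L
         @ map (\<lambda>a. a + w) L @ take 1 E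
         @ map (\<lambda>a. a + 2 * w) L @ drop 1 E)"

text \<open>The union over \<^term>\<open>n\<close> of the maps sending each level of tower \<^term>\<open>n\<close> other than the top
  one by translation onto the level above it. Only arguments in the half-line matter.\<close>

definition chacon :: "real \<Rightarrow> real" where
  "chacon x = (THE y. \<exists>n i. Suc i < length (tower n)
      \<and> x \<in> {tower n ! i ..< tower n ! i + level_width n}
      \<and> y = tower n ! Suc i + (x - tower n ! i))"

definition chacon_space :: "real measure" where
  "chacon_space = restrict_space lborel {0..}"


section \<open>Dynamical systems and homomorphisms\<close>

definition standard_borel :: "'a measure \<Rightarrow> bool" where
  "standard_borel M \<longleftrightarrow> (\<exists>\<tau>. topspace \<tau> = space M \<and> completely_metrizable_space \<tau>
      \<and> separable_space \<tau> \<and> sets M = sigma_sets (space M) {U. openin \<tau> U})"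

definition measure_preserving :: "'a measure \<Rightarrow> ('a \<Rightarrow> 'a) \<Rightarrow> bool" where
  "measure_preserving M T \<longleftrightarrow> T \<in> M \<rightarrow>\<^sub>M M \<and> distr M M T = M"

definition invertible_mod_null :: "'a measure \<Rightarrow> ('a \<Rightarrow> 'a) \<Rightarrow> bool" where
  "invertible_mod_null M T \<longleftrightarrow>
     (\<exists>S \<in> M \<rightarrow>\<^sub>M M. (AE x in M. S (T x) = x) \<and> (AE x in M. T (S x) = x))"

definition dynamical_system :: "'a measure \<Rightarrow> ('a \<Rightarrow> 'a) \<Rightarrow> bool" where
  "dynamical_system M T \<longleftrightarrow> standard_borel M \<and> sigma_finite_measure M
      \<and> measure_preserving M T \<and> invertible_mod_null M T"

text \<open>A homomorphism is a map defined almost everywhere. Its domain \<^term>\<open>D\<close>, a measurable set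
  with null complement, is explicit; the values of \<^term>\<open>\<pi>\<close> outside \<^term>\<open>D\<close> are irrelevant.
  In the equivariance condition, \<^prop>\<open>T x \<in> D\<close> holds for almost every \<^term>\<open>x\<close> because
  \<^term>\<open>T\<close> preserves \<^term>\<open>M\<close>.\<close>

definition homomorphism ::
    "'a measure \<Rightarrow> ('a \<Rightarrow> 'a) \<Rightarrow> 'b measure \<Rightarrow> ('b \<Rightarrow> 'b) \<Rightarrow> 'a set \<Rightarrow> ('a \<Rightarrow> 'b) \<Rightarrow> bool" where
  "homomorphism M T N R D \<pi> \<longleftrightarrow>
     D \<in> sets M \<and> space M - D \<in> null_sets M
     \<and> \<pi> \<in> restrict_space M D \<rightarrow>\<^sub>M N
     \<and> (AE x in M. \<pi> (T x) = R (\<pi> x))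
     \<and> distr (restrict_space M D) N \<pi> = N"

definition factor_of ::
    "'b measure \<Rightarrow> ('b \<Rightarrow> 'b) \<Rightarrow> 'a measure \<Rightarrow> ('a \<Rightarrow> 'a) \<Rightarrow> bool" where
  "factor_of N R M T \<longleftrightarrow> dynamical_system N R \<and> (\<exists>D \<pi>. homomorphism M T N R D \<pi>)"

definition isomorphism ::
    "'a measure \<Rightarrow> ('a \<Rightarrow> 'a) \<Rightarrow> 'b measure \<Rightarrow> ('b \<Rightarrow> 'b) \<Rightarrow> 'a set \<Rightarrow> ('a \<Rightarrow> 'b) \<Rightarrow> bool" where
  "isomorphism M T N R D \<pi> \<longleftrightarrow> homomorphism M T N R D \<pi>
     \<and> (\<exists>\<phi> \<in> N \<rightarrow>\<^sub>M M. (AE x in M. \<phi> (\<pi> x) = x) \<and> (AE z in N. \<phi> z \<in> D \<and> \<pi> (\<phi> z) = z))"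

end

theory Submission
  imports Defs
begin

text \<open>
  A factor of the infinite Chacon transformation loses nothing because a single observable of the
  factor already tells where a point sits in the towers.  Let \<open>\<pi>\<close> be a homomorphism onto \<open>\<rho>\<close>.  By
  \<open>\<sigma>\<close>-finiteness there is a set \<open>B\<close> with \<open>0 < \<rho> B < \<infinity>\<close>; its preimage \<open>A\<close> has the same measure, and
  the name of \<open>x\<close>, the sequence telling which iterates of \<open>x\<close> lie in \<open>A\<close>, is a function of \<open>\<pi> x\<close>.

  The levels of tower \<open>n\<close> are exactly the first triadic intervals of length \<open>3 ^ -n\<close>, so for large \<open>n\<close>
  the set \<open>A\<close> is nearly a union of levels, indexed by a word \<open>W\<close> of positions in tower \<open>n + 1\<close>.
  The word can be taken in the lower half of the tower, since the upper half consists of fresh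
  intervals beyond tower \<open>n\<close>.  On most columns the name agrees with \<open>W\<close> up to a small proportion of
  errors.  If the same name could be read in this way from two positions \<open>k > 0\<close> apart, then
  \<open>W\<close> would nearly coincide with its translate by \<open>k\<close>.

  This is impossible uniformly in \<open>n\<close> (lemma \<open>approximating_words_separated\<close>).  Compare \<open>W\<close> with the
  word \<open>P\<close> of a fixed good approximation of \<open>A\<close>, made of levels of some tower \<open>n0 + 1\<close> and rewritten in
  levels of tower \<open>n + 1\<close>.  Every translate of \<open>P\<close> by at least \<open>K = body n0\<close> misses at least a third of \<open>P\<close>
  (lemma \<open>iterated_refine_shift\<close>): rewriting replaces a word by three copies of itself separated by
  gaps no shorter than the window it occupies, so a translation either moves everything off the first copy or acts
  on the three copies separately.  Small translations are reduced to large ones by iteration: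
  the loss under \<open>K * k\<close> is at most \<open>K\<close> times the loss under \<open>k\<close>.

  Along a sequence of towers with summable errors, Borel-Cantelli shows that almost every \<open>x\<close> is
  eventually read correctly.  Its position in tower \<open>n + 1\<close> is then the least \<open>q\<close> for which the name seen
  from the \<open>q\<close>-th backward iterate is close to \<open>W\<close> (lemma \<open>position_from_name\<close>), and the corresponding
  levels shrink to \<open>x\<close>.  This recipe is a measurable map \<open>\<phi>\<close> with \<open>\<phi> (\<pi> x) = x\<close> almost everywhere
  (lemma \<open>left_inverse_exists\<close>).  That \<open>\<pi> (\<phi> z) = z\<close> almost everywhere follows because \<open>\<rho>\<close> is the image
  measure and countably many measurable sets separate the points of a standard Borel space.
\<close>


section \<open>Towers as stacks of triadic intervals\<close>

lemma leftmost_free_initial: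
  assumes "0 \<le> b" "0 < w"
  shows "leftmost_free w {0..<b} = b"
  unfolding leftmost_free_def
proof (rule Least_equality)
  show "0 \<le> b \<and> {b..<b + w} \<inter> {0..<b} = {}"
    using assms by auto
  fix t assume t: "0 \<le> t \<and> {t..<t + w} \<inter> {0..<b} = {}"
  have "t \<in> {t..<t + w}" using assms by simp
  then have "t \<notin> {0..<b}" using t by blast
  then show "b \<le> t" using t by simp
qed

text \<open>The used part of the half-line is always an initial interval, so successive leftmost picks are
  adjacent.\<close>

lemma extra_intervals_initial:
  assumes "0 \<le> b" "0 < w"
  shows "extra_intervals w k {0..<b} = map (\<lambda>i. b + real i * w) [0..<k]"
  using assms(1)
proof (induction k arbitrary: b)
  case (Suc k)
  have U: "{0..<b} \<union> {b..<b + w} = {0..<b + w}"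
    using Suc.prems assms(2) by (intro ivl_disj_un) auto
  have "map (\<lambda>i. b + real i * w) [0..<Suc k]
      = b # map (\<lambda>i. b + w + real i * w) [0..<k]"
    unfolding upt_conv_Cons[OF zero_less_Suc] map_Suc_upt[symmetric]
    by (simp add: algebra_simps)
  then show ?case
    using Suc.IH[of "b + w"] Suc.prems assms(2)
    by (simp add: leftmost_free_initial Let_def U)
qed simp

declare tower.simps(2) [simp del]

abbreviation height :: "nat \<Rightarrow> nat" where
  "height n \<equiv> length (tower n)"

text \<open>The three subcolumns of tower \<open>n\<close> and the spacer over the middle one form the lower half of tower
  \<open>n + 1\<close>; above it there are only new intervals.\<close>

definition body :: "nat \<Rightarrow> nat" where
  "body n = 3 * height n + 1"

definition level :: "nat \<Rightarrow> nat \<Rightarrow> real set" where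
  "level n i = {tower n ! i ..< tower n ! i + level_width n}"

lemma triadic_intervals_Union:
  "(\<Union>m<k. {real m * w..<real m * w + w}) = {0..<real k * w}" if "0 < w"
proof (induction k)
  case (Suc k)
  have "{0..<real k * w} \<union> {real k * w..<real k * w + w} = {0..<real (Suc k) * w}"
    using that by (simp add: ivl_disj_un algebra_simps)
  then show ?case by (simp only: lessThan_Suc UN_insert Suc.IH Un_commute)
qed simp

lemma level_width_pos [simp]: "0 < level_width n"
  by (simp add: level_width_def)

lemma level_width_Suc: "level_width n = 3 * level_width (Suc n)"
  by (simp add: level_width_def)

lemma image_lessThan_add:
  "f ` {..<a + b} = f ` {..<a} \<union> (\<lambda>i. f (a + i)) ` {..<b::nat}"
proof -
  have "{..<a + b} = {..<a} \<union> (\<lambda>i. a + i) ` {..<b}"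
    using image_add_atLeastLessThan[of a 0 b] ivl_disj_un(8)[of a "a + b"] by (simp add: atLeast0LessThan add.commute)
  then show ?thesis by (simp add: image_Un image_image)
qed

text \<open>The explicit shape of the next tower rests on the used part being an initial interval, and that the
  used part of the next tower is again one is read off this shape.  The hypothesis breaks the circle:
  \<open>set_tower\<close> discharges it by induction.\<close>

lemma tower_Suc_aux:
  assumes "set (tower n) = (\<lambda>m. real m * level_width n) ` {..<height n}"
  shows "tower (Suc n) = tower n
     @ map (\<lambda>a. a + level_width (Suc n)) (tower n)
     @ [real (height n) * level_width n]
     @ map (\<lambda>a. a + 2 * level_width (Suc n)) (tower n)
     @ map (\<lambda>i. real (3 * height n + 1 + i) * level_width (Suc n)) [0..<body n]"
proof -
  let ?w = "level_width (Suc n)" and ?h = "height n"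
  have U: "(\<Union>a\<in>set (tower n). {a..<a + level_width n}) = {0..<real ?h * level_width n}"
    unfolding assms using triadic_intervals_Union[of "level_width n" ?h] by simp
  have E: "extra_intervals ?w (1 + (3 * ?h + 1)) {0..<real ?h * level_width n}
      = map (\<lambda>i. real ?h * level_width n + real i * ?w) [0..<1 + (3 * ?h + 1)]"
    by (rule extra_intervals_initial) (auto simp: less_imp_le)
  have M: "map (\<lambda>i. real ?h * level_width n + real i * ?w) [0..<1 + (3 * ?h + 1)]
      = [real ?h * level_width n] @ map (\<lambda>i. real (3 * ?h + 1 + i) * ?w) [0..<body n]"
    by (rule nth_equalityI)
      (auto simp: body_def level_width_Suc[of n] nth_Cons algebra_simps split: nat.splits
        simp del: upt_Suc)
  show ?thesis
    by (simp only: tower.simps(2) Let_def U E M) simp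
qed

lemma set_tower: "set (tower n) = (\<lambda>m. real m * level_width n) ` {..<height n}"
proof (induction n)
  case 0
  then show ?case by (auto simp: lessThan_Suc)
next
  case (Suc n)
  let ?w = "level_width (Suc n)" and ?h = "height n"
  let ?f = "\<lambda>m. real m * ?w"
  have len: "height (Suc n) = 3 * ?h + 1 + body n"
    by (subst tower_Suc_aux[OF Suc.IH]) (simp add: body_def)
  have three: "{..<3 * ?h} = (\<lambda>m. 3 * m) ` {..<?h} \<union> (\<lambda>m. 3 * m + 1) ` {..<?h} \<union> (\<lambda>m. 3 * m + 2) ` {..<?h}"
  proof (intro set_eqI iffI)
    fix x assume "x \<in> {..<3 * ?h}"
    then have "x div 3 < ?h" "x = 3 * (x div 3) + x mod 3" "x mod 3 = 0 \<or> x mod 3 = 1 \<or> x mod 3 = 2"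
      by auto
    then show "x \<in> (\<lambda>m. 3 * m) ` {..<?h} \<union> (\<lambda>m. 3 * m + 1) ` {..<?h} \<union> (\<lambda>m. 3 * m + 2) ` {..<?h}"
      by (metis (no_types, lifting) UnI1 UnI2 add_0_right image_eqI lessThan_iff)
  qed auto
  \<comment> \<open>Each old triadic interval is the union of three new ones, one in each subcolumn.\<close>
  have cols: "?f ` {..<3 * ?h} = (\<lambda>m. real m * level_width n) ` {..<?h}
      \<union> (\<lambda>m. real m * level_width n + ?w) ` {..<?h} \<union> (\<lambda>m. real m * level_width n + 2 * ?w) ` {..<?h}"
    unfolding three image_Un image_image by (simp add: level_width_Suc[of n] algebra_simps)
  have "?f ` {..<height (Suc n)} = ?f ` {..<3 * ?h} \<union> {?f (3 * ?h)} \<union> (\<lambda>i. ?f (3 * ?h + 1 + i)) ` {..<body n}"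
    unfolding len image_lessThan_add by (simp add: lessThan_Suc Un_commute)
  also have "\<dots> = set (tower (Suc n))"
    unfolding cols by (subst tower_Suc_aux[OF Suc.IH])
      (auto simp: Suc.IH image_image level_width_Suc[of n] atLeast0LessThan)
  finally show ?case by (rule sym)
qed

lemmas tower_Suc = tower_Suc_aux[OF set_tower]

lemma height_Suc: "height (Suc n) = 2 * body n"
  by (subst tower_Suc) (simp add: body_def)

lemma distinct_if_set_eq_inj_image:
  "distinct xs" if "set xs = f ` {..<length xs}" "inj_on f {..<length xs}"
  using that by (metis card_distinct card_image card_lessThan)

lemma distinct_tower: "distinct (tower n)"
  by (rule distinct_if_set_eq_inj_image[OF set_tower]) (auto simp: inj_on_def level_width_def)

lemma tower_nth_0: "tower n ! 0 = 0"
proof (induction n)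
  case (Suc n)
  have "0 < height n" by (cases n) (auto simp: height_Suc body_def)
  with Suc show ?case by (subst tower_Suc) (simp add: nth_append)
qed simp

lemma tower_Suc_first: "i < height n \<Longrightarrow> tower (Suc n) ! i = tower n ! i"
  by (subst tower_Suc) (simp add: nth_append)

lemma tower_Suc_second:
  "i < height n \<Longrightarrow> tower (Suc n) ! (height n + i) = tower n ! i + level_width (Suc n)"
  by (subst tower_Suc) (simp add: nth_append)

lemma tower_Suc_third:
  "i < height n \<Longrightarrow> tower (Suc n) ! (2 * height n + 1 + i) = tower n ! i + 2 * level_width (Suc n)"
  by (subst tower_Suc) (simp add: nth_append)

lemma tower_nth_triadic:
  assumes "i < height n"
  obtains m where "m < height n" "tower n ! i = real m * level_width n"
  using nth_mem[OF assms] set_tower[of n] by auto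

lemma tower_nth_nonneg: "i < height n \<Longrightarrow> 0 \<le> tower n ! i"
  by (metis level_width_pos less_imp_le mult_nonneg_nonneg of_nat_0_le_iff tower_nth_triadic)

lemma Union_levels: "(\<Union>i<height n. level n i) = {0..<real (height n) * level_width n}"
proof -
  have "(\<Union>i<height n. level n i) = (\<Union>a\<in>set (tower n). {a..<a + level_width n})"
    by (auto simp: level_def set_conv_nth)
  then show ?thesis
    using triadic_intervals_Union[of "level_width n" "height n"] by (simp add: set_tower)
qed

text \<open>Two levels of one tower are distinct triadic intervals of the same generation.\<close>

lemma level_disjoint:
  assumes "i < height n" "j < height n" "x \<in> level n i" "x \<in> level n j"
  shows "i = j"
proof -
  obtain a where a: "tower n ! i = real a * level_width n" by (rule tower_nth_triadic[OF assms(1)])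
  obtain b where b: "tower n ! j = real b * level_width n" by (rule tower_nth_triadic[OF assms(2)])
  have pos: "0 < level_width n" by simp
  have "real a * level_width n < (real b + 1) * level_width n" "real b * level_width n < (real a + 1) * level_width n"
    using assms(3,4) a b by (auto simp: level_def algebra_simps)
  then have "real a < real b + 1" "real b < real a + 1"
    using mult_less_cancel_right_pos[OF pos] by auto
  then have "a = b" by linarith
  then show ?thesis
    using a b nth_eq_iff_index_eq[OF distinct_tower assms(1,2)] by simp
qed

lemma disjoint_family_levels: "disjoint_family_on (level n) {..<height n}"
  unfolding disjoint_family_on_def using level_disjoint by blast

lemma level_split:
  assumes "i < height n"
  shows "level n i = level (Suc n) i \<union> level (Suc n) (height n + i) \<union> level (Suc n) (2 * height n + 1 + i)"
  unfolding level_def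
    tower_Suc_first[OF assms] tower_Suc_second[OF assms] tower_Suc_third[OF assms] level_width_Suc[of n]
  using level_width_pos[of "Suc n"] by auto

text \<open>The extent of the tower at least doubles at every step, since the upper half is new; hence the
  measure is infinite and the towers exhaust the half-line.\<close>

lemma tower_extent_ge: "2 ^ n \<le> real (height n) * level_width n"
proof (induction n)
  case (Suc n)
  have "2 ^ Suc n \<le> 2 * (real (height n) * level_width n)"
    using Suc by simp
  also have "\<dots> \<le> 2 * (real (height n) * level_width n) + 2 * level_width (Suc n)"
    by (simp add: less_imp_le)
  also have "\<dots> = real (height (Suc n)) * level_width (Suc n)"
    by (simp add: height_Suc body_def level_width_Suc[of n] algebra_simps)
  finally show ?case .
qed (simp add: level_width_def)

section \<open>The transformation along a column\<close>

text \<open>Cutting and stacking keeps the translation from a level to the next one: consecutive levels of a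
  tower stay consecutive inside each of the three subcolumns.\<close>

lemma step_refine_Suc:
  assumes "Suc i < height n" "x \<in> level n i"
  shows "\<exists>j. Suc j < height (Suc n) \<and> x \<in> level (Suc n) j
     \<and> tower (Suc n) ! Suc j - tower (Suc n) ! j = tower n ! Suc i - tower n ! i"
proof -
  have i: "i < height n" using assms by simp
  have S: "Suc (height n + i) = height n + Suc i" "Suc (2 * height n + 1 + i) = 2 * height n + 1 + Suc i"
    by simp_all
  have "x \<in> level (Suc n) i \<or> x \<in> level (Suc n) (height n + i) \<or> x \<in> level (Suc n) (2 * height n + 1 + i)"
    using assms(2) level_split[OF i] by blast
  then show ?thesis
  proof (elim disjE)
    assume "x \<in> level (Suc n) i"
    then show ?thesis using assms i
      by (intro exI[of _ i]) (simp add: tower_Suc_first height_Suc body_def)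
  next
    assume "x \<in> level (Suc n) (height n + i)"
    then show ?thesis using assms(1) i
      by (intro exI[of _ "height n + i"]) (simp only: S tower_Suc_second, simp add: height_Suc body_def)
  next
    assume "x \<in> level (Suc n) (2 * height n + 1 + i)"
    then show ?thesis using assms(1) i
      by (intro exI[of _ "2 * height n + 1 + i"]) (simp only: S tower_Suc_third, simp add: height_Suc body_def)
  qed
qed

lemma step_refine:
  assumes "Suc i < height n" "x \<in> level n i" "n \<le> m"
  shows "\<exists>j. Suc j < height m \<and> x \<in> level m j
     \<and> tower m ! Suc j - tower m ! j = tower n ! Suc i - tower n ! i"
  using assms(3)
proof (induction m rule: dec_induct)
  case base
  then show ?case using assms by auto
next
  case (step m)
  then obtain j where j: "Suc j < height m" "x \<in> level m j"
     "tower m ! Suc j - tower m ! j = tower n ! Suc i - tower n ! i" by blast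
  from step_refine_Suc[OF j(1,2)] show ?case unfolding j(3) .
qed

text \<open>Any two descriptions of the image of \<open>x\<close> can be compared in one common later tower, in which \<open>x\<close> has
  a single position.\<close>

lemma chacon_level:
  assumes "Suc i < height n" "x \<in> level n i"
  shows "chacon x = tower n ! Suc i + (x - tower n ! i)"
  unfolding chacon_def
proof (rule the_equality)
  show "\<exists>m j. Suc j < height m \<and> x \<in> {tower m ! j..<tower m ! j + level_width m}
     \<and> tower n ! Suc i + (x - tower n ! i) = tower m ! Suc j + (x - tower m ! j)"
    using assms unfolding level_def by blast
  fix y assume "\<exists>m j. Suc j < height m \<and> x \<in> {tower m ! j..<tower m ! j + level_width m}
     \<and> y = tower m ! Suc j + (x - tower m ! j)"
  then obtain m j where mj: "Suc j < height m" "x \<in> level m j" and y: "y = tower m ! Suc j + (x - tower m ! j)"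
    unfolding level_def by blast
  let ?M = "max n m"
  obtain a where a: "Suc a < height ?M" "x \<in> level ?M a"
      "tower ?M ! Suc a - tower ?M ! a = tower n ! Suc i - tower n ! i"
    using step_refine[OF assms, of ?M] by auto
  obtain b where b: "Suc b < height ?M" "x \<in> level ?M b"
      "tower ?M ! Suc b - tower ?M ! b = tower m ! Suc j - tower m ! j"
    using step_refine[OF mj, of ?M] by auto
  have "a = b" using level_disjoint[of a ?M b x] a b by simp
  then show "y = tower n ! Suc i + (x - tower n ! i)" using a(3) b(3) y by simp
qed

lemma chacon_step:
  assumes "Suc j < height n" "y \<in> level n 0"
  shows "chacon (y + tower n ! j) = y + tower n ! Suc j"
proof -
  have "y + tower n ! j \<in> level n j"
    using assms(2) by (simp add: level_def tower_nth_0)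
  from chacon_level[OF assms(1) this] show ?thesis by simp
qed


section \<open>Words and their translates\<close>

definition level_union :: "nat \<Rightarrow> nat set \<Rightarrow> real set" where
  "level_union n P = (\<Union>p\<in>P. level n p)"

text \<open>A set of positions in tower \<open>n\<close> becomes the set of positions in tower \<open>n + 1\<close> whose levels have the
  same union (see \<open>level_union_refine\<close>).\<close>

definition refine :: "nat \<Rightarrow> nat set \<Rightarrow> nat set" where
  "refine n P = P \<union> (+) (height n) ` P \<union> (+) (2 * height n + 1) ` P"

lemma refine_subset: "P \<subseteq> {..<height n} \<Longrightarrow> refine n P \<subseteq> {..<body n}"
  unfolding refine_def body_def by force

lemma below_body_below_height: "P \<subseteq> {..<body n} \<Longrightarrow> P \<subseteq> {..<height (Suc n)}"
  by (force simp: height_Suc)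

lemma level_union_refine:
  assumes "P \<subseteq> {..<height n}"
  shows "level_union (Suc n) (refine n P) = level_union n P"
proof -
  have "level_union n P = (\<Union>p\<in>P. level (Suc n) p \<union> level (Suc n) (height n + p) \<union> level (Suc n) (2 * height n + 1 + p))"
    unfolding level_union_def using assms level_split by (intro SUP_cong) auto
  then show ?thesis
    unfolding level_union_def refine_def by (simp only: image_Un Union_Un_distrib image_image UN_Un_distrib)
qed

lemma card_refine:
  assumes "P \<subseteq> {..<height n}"
  shows "card (refine n P) = 3 * card P"
proof -
  have fin: "finite P" using assms finite_subset by blast
  have 1: "card (P \<union> (+) (height n) ` P) = card P + card ((+) (height n) ` P)"
    using assms fin by (intro card_Un_disjoint) auto
  have 2: "card (refine n P) = card (P \<union> (+) (height n) ` P) + card ((+) (2 * height n + 1) ` P)"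
    unfolding refine_def using assms fin by (intro card_Un_disjoint) force+
  have "card ((+) c ` P) = card P" for c :: nat
    by (rule card_image) simp
  then show ?thesis unfolding 2 1 by presburger
qed

text \<open>One step of the induction on scales.  A translation by at least \<open>body n\<close> moves everything off the
  first copy of \<open>P\<close>, a third of the total.  Under a shorter translation each copy stays within its
  own window of length \<open>2 * body n\<close>, so that the three copies lose elements independently and the
  proportion lost is that of \<open>P\<close>.\<close>

lemma refine_shift:
  assumes P: "P \<subseteq> {..<body n}"
    and IH: "k < body n \<Longrightarrow> card P \<le> 3 * card (P - (+) k ` P)"
  shows "card (refine (Suc n) P) \<le> 3 * card (refine (Suc n) P - (+) k ` refine (Suc n) P)"
proof -
  let ?L = "body n" and ?P' = "refine (Suc n) P"
  have fin: "finite P" using P finite_subset by blast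
  then have fin': "finite ?P'" by (simp add: refine_def)
  have sub: "P \<subseteq> {..<height (Suc n)}" using P by (rule below_body_below_height)
  show ?thesis
  proof (cases "k < ?L")
    case False
    have "P \<subseteq> ?P' - (+) k ` ?P'"
      using P False by (auto simp: refine_def)
    then have "card P \<le> card (?P' - (+) k ` ?P')"
      using fin' by (intro card_mono) auto
    then show ?thesis by (simp add: card_refine[OF sub])
  next
    case True
    let ?D = "P - (+) k ` P"
    have less: "p < ?L" if "p \<in> P" for p using P that by auto
    have "refine (Suc n) ?D \<subseteq> ?P' - (+) k ` ?P'"
    proof
      fix x assume "x \<in> refine (Suc n) ?D"
      then obtain c p where c: "c \<in> {0, 2 * ?L, 4 * ?L + 1}" and p: "p \<in> P" "p \<notin> (+) k ` P" and x: "x = c + p"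
        unfolding refine_def height_Suc by force
      have "x \<in> ?P'" using c p x unfolding refine_def height_Suc by auto
      moreover have "x \<notin> (+) k ` ?P'"
      proof
        assume "x \<in> (+) k ` ?P'"
        then obtain d q where d: "d \<in> {0, 2 * ?L, 4 * ?L + 1}" and q: "q \<in> P" and xq: "x = k + (d + q)"
          unfolding refine_def height_Suc by force
        have "c = d" using c d less[OF p(1)] less[OF q] True x xq by auto
        then have "p = k + q" using x xq by simp
        with q p(2) show False by auto
      qed
      ultimately show "x \<in> ?P' - (+) k ` ?P'" by blast
    qed
    then have "card (refine (Suc n) ?D) \<le> card (?P' - (+) k ` ?P')"
      using fin' by (intro card_mono) auto
    moreover have "card (refine (Suc n) ?D) = 3 * card ?D"
      using sub by (intro card_refine) auto
    ultimately show ?thesis using IH[OF True] by (simp add: card_refine[OF sub])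
  qed
qed

text \<open>At the initial scale a translate by at least \<open>body n0\<close> is disjoint from the word; afterwards
  \<open>refine_shift\<close> keeps the proportion at one third.\<close>

lemma iterated_refine_shift:
  assumes P0: "P0 \<subseteq> {..<body n0}" and "n0 \<le> n"
  shows "\<exists>P \<subseteq> {..<body n}. level_union (Suc n) P = level_union (Suc n0) P0
     \<and> (\<forall>k\<ge>body n0. card P \<le> 3 * card (P - (+) k ` P))"
  using \<open>n0 \<le> n\<close>
proof (induction n rule: dec_induct)
  case base
  have "P0 - (+) k ` P0 = P0" if "body n0 \<le> k" for k
    using P0 that by auto
  then show ?case using P0 by (intro exI[of _ P0]) auto
next
  case (step n)
  then obtain P where P: "P \<subseteq> {..<body n}" "level_union (Suc n) P = level_union (Suc n0) P0"
     "\<forall>k\<ge>body n0. card P \<le> 3 * card (P - (+) k ` P)" by blast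
  have sub: "P \<subseteq> {..<height (Suc n)}" using P(1) by (rule below_body_below_height)
  show ?case
    using P refine_shift[OF P(1)]
    by (intro exI[of _ "refine (Suc n) P"]) (simp add: refine_subset[OF sub] level_union_refine[OF sub])
qed

text \<open>An element lost under \<open>m\<close> successive translations by \<open>k\<close> is lost at one of them.\<close>

lemma card_diff_shift_iterate:
  fixes W :: "nat set"
  assumes "finite W"
  shows "card (W - (+) (m * k) ` W) \<le> m * card (W - (+) k ` W)"
proof (induction m)
  case (Suc m)
  have "W - (+) (Suc m * k) ` W \<subseteq> (W - (+) (m * k) ` W) \<union> (+) (m * k) ` (W - (+) k ` W)"
    by (auto simp: image_iff algebra_simps)
  then have "card (W - (+) (Suc m * k) ` W)
      \<le> card ((W - (+) (m * k) ` W) \<union> (+) (m * k) ` (W - (+) k ` W))"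
    using assms by (intro card_mono) auto
  also have "\<dots> \<le> card (W - (+) (m * k) ` W) + card ((+) (m * k) ` (W - (+) k ` W))"
    by (rule card_Un_le)
  also have "card ((+) (m * k) ` (W - (+) k ` W)) = card (W - (+) k ` W)"
    by (simp add: card_image)
  finally show ?case using Suc by simp
qed simp

lemma card_diff_shift_perturb:
  fixes W P :: "nat set"
  assumes "finite W" "finite P"
  shows "card (P - (+) k ` P) \<le> card (W - (+) k ` W) + card (P - W) + card (W - P)"
proof -
  have "P - (+) k ` P \<subseteq> (W - (+) k ` W) \<union> (P - W) \<union> (+) k ` (W - P)"
    by blast
  then have "card (P - (+) k ` P) \<le> card ((W - (+) k ` W) \<union> (P - W) \<union> (+) k ` (W - P))"
    using assms by (intro card_mono) auto
  also have "\<dots> \<le> card (W - (+) k ` W) + card (P - W) + card ((+) k ` (W - P))"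
    using card_Un_le[of "(W - (+) k ` W) \<union> (P - W)" "(+) k ` (W - P)"]
      card_Un_le[of "W - (+) k ` W" "P - W"] by linarith
  finally show ?thesis by (simp add: card_image)
qed

section \<open>Approximation by unions of levels\<close>

lemma level_measurable [measurable, simp]: "level n i \<in> sets borel"
  by (simp add: level_def)

lemma level_union_measurable [measurable, simp]: "level_union n P \<in> sets borel"
  unfolding level_union_def by (intro sets.countable_UN') auto

lemma emeasure_level_union:
  assumes "P \<subseteq> {..<height n}"
  shows "emeasure lborel (level_union n P) = ennreal (real (card P) * level_width n)"
proof -
  have fin: "finite P" using assms finite_subset by blast
  have "emeasure lborel (level_union n P) = (\<Sum>p\<in>P. emeasure lborel (level n p))"
    unfolding level_union_def using fin disjoint_family_on_mono[OF assms disjoint_family_levels]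
    by (intro sum_emeasure[symmetric]) auto
  also have "\<dots> = (\<Sum>p\<in>P. ennreal (level_width n))"
    by (simp add: level_def less_imp_le)
  finally show ?thesis
    by (simp add: ennreal_mult ennreal_of_nat_eq_real_of_nat less_imp_le)
qed

lemma measure_level_union:
  "P \<subseteq> {..<height n} \<Longrightarrow> measure lborel (level_union n P) = real (card P) * level_width n"
  by (simp add: measure_def emeasure_level_union less_imp_le)

lemma level_union_fmeasurable: "P \<subseteq> {..<height n} \<Longrightarrow> level_union n P \<in> fmeasurable lborel"
  by (simp add: fmeasurable_def emeasure_level_union)

lemma level_union_Diff:
  assumes "P \<subseteq> {..<height n}" "Q \<subseteq> {..<height n}"
  shows "level_union n P - level_union n Q = level_union n (P - Q)"
  using assms level_disjoint unfolding level_union_def by fast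


lemma level_width_tendsto: "level_width \<longlonglongrightarrow> 0"
proof -
  have "level_width = (\<lambda>n. (1/3) ^ n)"
    by (auto simp: level_width_def power_one_over)
  moreover have "(\<lambda>n. (1/3 :: real) ^ n) \<longlonglongrightarrow> 0" by (intro LIMSEQ_power_zero) simp
  ultimately show ?thesis by simp
qed

lemma eventually_in_tower: "eventually (\<lambda>n. x < real (height n) * level_width n) sequentially"
proof -
  have "eventually (\<lambda>n. x < 2 ^ n) sequentially"
    using filterlim_realpow_sequentially_gt1[of "2 :: real"]
    by (simp add: filterlim_at_infinity_conv_norm_at_top filterlim_at_top_dense)
  then show ?thesis
    by eventually_elim (meson tower_extent_ge order_less_le_trans)
qed

lemma Union_levels_refined: "{0..<real (height n) * level_width n} = level_union (Suc n) (refine n {..<height n})"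
  by (simp add: level_union_refine Union_levels[symmetric]) (simp add: level_union_def)

text \<open>Squeeze a compact set \<open>K\<close> and an open set \<open>U\<close> around most of \<open>A\<close>; once levels are shorter than the
  distance from \<open>K\<close> to the complement of \<open>U\<close>, the levels meeting \<open>K\<close> have their union in between.
  Taking them inside tower \<open>n\<close>, which eventually contains \<open>K\<close>, keeps their positions in tower \<open>n + 1\<close>
  below \<open>body n\<close>.\<close>

lemma approx_by_levels:
  assumes [measurable]: "A \<in> sets borel" and "A \<subseteq> {0..}" "emeasure lborel A < \<infinity>" "0 < e"
  shows "eventually (\<lambda>n. \<exists>W \<subseteq> {..<body n}.
     measure lborel (sym_diff A (level_union (Suc n) W)) < e) sequentially"
proof -
  have Am: "A \<in> fmeasurable lborel" using assms by (simp add: fmeasurable_def)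
  have "(\<lambda>i. measure lborel (A \<inter> {real i..})) \<longlonglongrightarrow> measure lborel (\<Inter>i. A \<inter> {real i..})"
  proof (rule Lim_measure_decseq)
    show "decseq (\<lambda>i. A \<inter> {real i..})" by (auto simp: decseq_def)
    show "emeasure lborel (A \<inter> {real i..}) \<noteq> \<infinity>" for i
      using emeasure_mono[of "A \<inter> {real i..}" A lborel] assms(3) by (auto simp: top_unique)
  qed auto
  moreover have "(\<Inter>i. A \<inter> {real i..}) = {}"
  proof -
    have "\<exists>i. x \<notin> A \<inter> {real i..}" for x
      using reals_Archimedean2[of x] by (force simp: not_le)
    then show ?thesis by blast
  qed
  ultimately have "(\<lambda>i. measure lborel (A \<inter> {real i..})) \<longlonglongrightarrow> 0" by simp
  then have "eventually (\<lambda>i. measure lborel (A \<inter> {real i..}) < e / 3) sequentially"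
    using \<open>0 < e\<close> by (intro order_tendstoD) auto
  then obtain M :: nat where M: "measure lborel (A \<inter> {real M..}) < e / 3"
    using eventually_happens'[OF sequentially_bot] by blast
  define A' where "A' = A \<inter> {..real M}"
  have A'[measurable]: "A' \<in> sets borel" unfolding A'_def by measurable
  obtain U where U: "open U" "A \<subseteq> U" "emeasure lborel (U - A) < ennreal (e / 3)"
    using outer_regular_lborel[of A "e / 3"] \<open>0 < e\<close> by auto
  \<comment> \<open>Outer regularity of the complement of \<open>A'\<close> is inner regularity of \<open>A'\<close>.\<close>
  obtain V where V: "open V" "- A' \<subseteq> V" "emeasure lborel (V - - A') < ennreal (e / 3)"
    using outer_regular_lborel[of "- A'" "e / 3"] \<open>0 < e\<close> A' by auto
  have [measurable]: "U \<in> sets borel" "V \<in> sets borel" using U V by auto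
  have UA: "U - A \<in> fmeasurable lborel" "measure lborel (U - A) < e / 3"
  proof -
    show *: "U - A \<in> fmeasurable lborel"
      using U(3) by (simp add: fmeasurable_def less_trans[OF _ ennreal_less_top])
    show "measure lborel (U - A) < e / 3"
      using U(3) emeasure_eq_measure2[OF *] \<open>0 < e\<close> by (simp add: ennreal_less_iff)
  qed
  define K where "K = - V"
  have KA: "A' - K \<in> fmeasurable lborel" "measure lborel (A' - K) < e / 3"
  proof -
    have eq: "A' - K = V - - A'" by (auto simp: K_def)
    show *: "A' - K \<in> fmeasurable lborel"
      using V(3) unfolding eq by (simp add: fmeasurable_def less_trans[OF _ ennreal_less_top])
    show "measure lborel (A' - K) < e / 3"
      using V(3) emeasure_eq_measure2[OF *] \<open>0 < e\<close> unfolding eq by (simp add: ennreal_less_iff)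
  qed
  have "K \<subseteq> A'" using V(2) by (auto simp: K_def)
  then have "K \<subseteq> A" "K \<subseteq> {..real M}" by (auto simp: A'_def)
  moreover have "K \<subseteq> {0..}" using \<open>K \<subseteq> A\<close> assms(2) by (rule order_trans)
  ultimately have K: "K \<subseteq> {0..real M}" "K \<subseteq> U"
    using U(2) by (auto simp: subset_iff)
  then have "bounded K" by (intro bounded_subset[OF bounded_closed_interval])
  then have "compact K"
    using V(1) by (simp add: K_def compact_eq_bounded_closed closed_Compl)
  then obtain \<delta> where \<delta>: "0 < \<delta>" "\<And>x y. x \<in> K \<Longrightarrow> y \<in> - U \<Longrightarrow> \<delta> \<le> dist x y"
    using separate_compact_closed[of K "- U"] U(1) K(2) by (auto simp: closed_Compl disjoint_eq_subset_Compl)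
  have "eventually (\<lambda>n. level_width (Suc n) < \<delta>) sequentially"
    using LIMSEQ_Suc[OF level_width_tendsto] \<delta>(1) by (rule order_tendstoD)
  then show ?thesis
    using eventually_in_tower[of "real M"]
  proof eventually_elim
    case (elim n)
    define W where "W = {p \<in> refine n {..<height n}. level (Suc n) p \<inter> K \<noteq> {}}"
    let ?L = "level_union (Suc n) W"
    have W: "W \<subseteq> {..<body n}" using refine_subset[of "{..<height n}" n] by (auto simp: W_def)
    have KL: "K \<subseteq> ?L"
    proof
      fix x assume x: "x \<in> K"
      then have "x \<in> level_union (Suc n) (refine n {..<height n})"
        using K(1) elim(2) unfolding Union_levels_refined[symmetric] by auto
      then show "x \<in> ?L" using x by (auto simp: level_union_def W_def)
    qed
    have LU: "?L \<subseteq> U"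
    proof
      fix x assume "x \<in> ?L"
      then obtain p y where "x \<in> level (Suc n) p" "y \<in> level (Suc n) p" and y: "y \<in> K"
        by (auto simp: level_union_def W_def)
      then have "dist y x < \<delta>" using elim(1) by (auto simp: level_def dist_real_def)
      then show "x \<in> U" using \<delta>(2)[OF y, of x] by force
    qed
    have "sym_diff A ?L \<subseteq> (A \<inter> {real M..}) \<union> (A' - K) \<union> (U - A)"
      using KL LU by (auto simp: A'_def)
    moreover have "(A \<inter> {real M..}) \<union> (A' - K) \<union> (U - A) \<in> fmeasurable lborel"
      using Am KA UA by (intro fmeasurable.Un fmeasurable_Int_fmeasurable) auto
    ultimately have "measure lborel (sym_diff A ?L) \<le> measure lborel ((A \<inter> {real M..}) \<union> (A' - K) \<union> (U - A))"
      by (intro measure_mono_fmeasurable) auto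
    also have "\<dots> \<le> measure lborel (A \<inter> {real M..}) + measure lborel (A' - K) + measure lborel (U - A)"
      using KA UA by (intro measure_Un_le[THEN order_trans] add_mono measure_Un_le order_refl) auto
    also have "\<dots> < e" using M KA(2) UA(2) by simp
    finally show ?case using W by blast
  qed
qed

text \<open>The factor \<open>3 ^ Suc n\<close> is the number of levels per unit of measure.  Uniformity in \<open>n\<close> and \<open>k\<close> comes from comparing
  with one fixed approximation \<open>W0\<close> rewritten in finer levels, for which translations by at least \<open>?K\<close>
  are controlled; a translation by \<open>k\<close> is repeated \<open>?K\<close> times to reach that range.\<close>

lemma approximating_words_separated:
  assumes A[measurable]: "A \<in> sets borel" and "A \<subseteq> {0..}" and pos: "0 < emeasure lborel A"
      and fin: "emeasure lborel A < \<infinity>"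
  shows "\<exists>\<eta>>0. \<forall>\<epsilon>>0. eventually (\<lambda>n. \<exists>W\<subseteq>{..<body n}.
      measure lborel (sym_diff A (level_union (Suc n) W)) < \<epsilon>
      \<and> (\<forall>k>0. 2 * (\<eta> * 3 ^ Suc n) < real (card (W - (+) k ` W)))) sequentially"
proof -
  define \<alpha> where "\<alpha> = measure lborel A"
  have Am: "A \<in> fmeasurable lborel" using fin by (simp add: fmeasurable_def)
  have \<alpha>: "0 < \<alpha>" using pos emeasure_eq_measure2[OF Am] by (simp add: \<alpha>_def)
  from approx_by_levels[OF A assms(2) fin, of "\<alpha> / 20"] \<alpha>
  obtain n0 W0 where W0: "W0 \<subseteq> {..<body n0}"
      "measure lborel (sym_diff A (level_union (Suc n0) W0)) < \<alpha> / 20"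
    by (auto simp: eventually_sequentially)
  let ?C = "level_union (Suc n0) W0" and ?K = "body n0"
  have Cm: "?C \<in> fmeasurable lborel" using W0(1) by (intro level_union_fmeasurable below_body_below_height)
  have C: "19 * \<alpha> / 20 \<le> measure lborel ?C"
  proof -
    have "\<alpha> - measure lborel ?C \<le> measure lborel (A - ?C)"
      unfolding \<alpha>_def using Am Cm by (rule measure_diff_le_measure_setdiff)
    also have "\<dots> \<le> measure lborel (sym_diff A ?C)"
      using Am Cm by (intro measure_mono_fmeasurable fmeasurable.Un fmeasurable.Diff) auto
    finally show ?thesis using W0(2) by simp
  qed
  \<comment> \<open>With \<open>c\<close> the loss of \<open>W\<close> and \<open>w\<close> the level width, the estimates below give
      \<open>19/20 \<alpha> \<le> 3 (K c w + \<alpha>/10)\<close>, hence \<open>K c w > \<alpha>/10 = 2 K \<eta>\<close>.\<close>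
  define \<eta> where "\<eta> = \<alpha> / (20 * real ?K)"
  have K: "0 < real ?K" by (simp add: body_def)
  have \<eta>: "0 < \<eta>" "\<eta> * real ?K = \<alpha> / 20" using \<alpha> K by (auto simp: \<eta>_def)
  show ?thesis
  proof (intro exI[of _ \<eta>] conjI allI impI)
    show "0 < \<eta>" by fact
    fix \<epsilon> :: real assume "0 < \<epsilon>"
    then have "0 < min \<epsilon> (\<alpha> / 20)" using \<alpha> by simp
    from approx_by_levels[OF A assms(2) fin this] eventually_ge_at_top[of n0]
    show "eventually (\<lambda>n. \<exists>W\<subseteq>{..<body n}.
      measure lborel (sym_diff A (level_union (Suc n) W)) < \<epsilon>
      \<and> (\<forall>k>0. 2 * (\<eta> * 3 ^ Suc n) < real (card (W - (+) k ` W)))) sequentially"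
    proof eventually_elim
      case (elim n)
      then obtain W where W: "W \<subseteq> {..<body n}"
        "measure lborel (sym_diff A (level_union (Suc n) W)) < \<epsilon>"
        "measure lborel (sym_diff A (level_union (Suc n) W)) < \<alpha> / 20" by auto
      obtain P where P: "P \<subseteq> {..<body n}" "level_union (Suc n) P = ?C"
         "\<forall>k\<ge>?K. card P \<le> 3 * card (P - (+) k ` P)"
        using iterated_refine_shift[OF W0(1) elim(2)] by blast
      let ?w = "level_width (Suc n)" and ?L = "level_union (Suc n) W"
      have h: "W \<subseteq> {..<height (Suc n)}" "P \<subseteq> {..<height (Suc n)}"
        using W(1) P(1) by (simp_all only: below_body_below_height)
      have fin': "finite W" "finite P" using h finite_subset by blast+
      have Lm: "?L \<in> fmeasurable lborel" using h(1) by (rule level_union_fmeasurable)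
      have cP: "real (card P) * ?w = measure lborel ?C"
        using measure_level_union[OF h(2)] P(2) by simp
      have "measure lborel (?C - ?L) + measure lborel (?L - ?C) = measure lborel (sym_diff ?C ?L)"
        using fmeasurable.Diff[OF Cm Lm] fmeasurable.Diff[OF Lm Cm]
        by (intro measure_Union[symmetric]) (auto dest: fmeasurableD2)
      also have "\<dots> \<le> measure lborel (sym_diff A ?C \<union> sym_diff A ?L)"
        using Cm Lm Am by (intro measure_mono_fmeasurable fmeasurable.Un fmeasurable.Diff) auto
      also have "\<dots> \<le> measure lborel (sym_diff A ?C) + measure lborel (sym_diff A ?L)"
        by (rule measure_Un_le) auto
      also have "\<dots> < \<alpha> / 10" using W0(2) W(3) by simp
      finally have d: "(real (card (P - W)) + real (card (W - P))) * ?w < \<alpha> / 10"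
        using measure_level_union[of "P - W" "Suc n"] measure_level_union[of "W - P" "Suc n"] h
          level_union_Diff[OF h] level_union_Diff[OF h(2,1)] P(2)
        by (simp add: algebra_simps subset_iff)
      have "2 * (\<eta> * 3 ^ Suc n) < real (card (W - (+) k ` W))" if "0 < k" for k
      proof -
        let ?c = "card (W - (+) k ` W)"
        have "card P \<le> 3 * card (P - (+) (?K * k) ` P)" using P(3) that by simp
        also have "\<dots> \<le> 3 * (?K * ?c + card (P - W) + card (W - P))"
          using card_diff_shift_perturb[OF fin', of "?K * k"] card_diff_shift_iterate[OF fin'(1), of ?K k]
          by simp
        finally have "real (card P) \<le> 3 * (real ?K * real ?c + real (card (P - W)) + real (card (W - P)))"
          by (metis of_nat_add of_nat_le_iff of_nat_mult of_nat_numeral)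
        then have "real (card P) * ?w \<le> (3 * (real ?K * real ?c + real (card (P - W)) + real (card (W - P)))) * ?w"
          by (intro mult_right_mono) (simp_all add: less_imp_le)
        then have "real (card P) * ?w \<le> 3 * (real ?K * (real ?c * ?w)) + 3 * ((real (card (P - W)) + real (card (W - P))) * ?w)"
          by (simp add: algebra_simps)
        with d C cP \<alpha> have "\<alpha> / 10 < real ?K * (real ?c * ?w)" by linarith
        then have "real ?K * (2 * \<eta>) < real ?K * (real ?c * ?w)" using \<eta>(2) by (simp add: algebra_simps)
        then have "2 * \<eta> < real ?c * ?w" using K by simp
        then show ?thesis by (simp add: level_width_def field_simps)
      qed
      with W show ?case by blast
    qed
  qed
qed

section \<open>Columns on which the name is nearly the word\<close>

text \<open>Reading \<open>W\<close> both in \<open>a\<close> and in its translate \<open>b\<close> gives control, inside the window, of the part of the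
  translate of \<open>W\<close> lying outside \<open>W\<close>.  As \<open>W\<close> and its translate have equally many elements, the part of
  \<open>W\<close> outside the translate has the same size.\<close>

lemma card_diff_shift_le_mismatches:
  fixes W :: "nat set"
  assumes "finite W" "\<And>j. j \<in> W \<Longrightarrow> j + k < h"
    and ab: "\<And>j. j + k < h \<Longrightarrow> b j = a (j + k)"
  shows "card (W - (+) k ` W) \<le> card {j\<in>{..<h}. a j \<noteq> (j \<in> W)} + card {j\<in>{..<h}. b j \<noteq> (j \<in> W)}"
proof -
  let ?a = "{j\<in>{..<h}. a j \<noteq> (j \<in> W)}" and ?b = "{j\<in>{..<h}. b j \<noteq> (j \<in> W)}"
  have "card (W - (+) k ` W) = card W - card (W \<inter> (+) k ` W)"
    using assms(1) by (intro card_Diff_subset_Int) auto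
  also have "card W = card ((+) k ` W)" by (simp add: card_image)
  also have "card ((+) k ` W) - card (W \<inter> (+) k ` W) = card ((+) k ` W - W)"
    using assms(1) by (subst card_Diff_subset_Int) (auto simp: Int_commute)
  also have "(+) k ` W - W \<subseteq> ?a \<union> (+) k ` ?b"
  proof
    fix x assume "x \<in> (+) k ` W - W"
    then obtain j where j: "j \<in> W" "x = k + j" "x \<notin> W" by auto
    show "x \<in> ?a \<union> (+) k ` ?b"
      using j ab[of j] assms(2)[of j] by (cases "b j") (auto simp: add.commute)
  qed
  then have "card ((+) k ` W - W) \<le> card (?a \<union> (+) k ` ?b)"
    by (intro card_mono) auto
  also have "\<dots> \<le> card ?a + card ((+) k ` ?b)" by (rule card_Un_le)
  finally show ?thesis by (simp add: card_image)
qed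

lemma emeasure_lborel_shift:
  fixes F :: "real set"
  assumes "F \<in> sets borel"
  shows "emeasure lborel {y. y + t \<in> F} = emeasure lborel F"
proof -
  have "emeasure lborel F = emeasure (distr lborel borel ((+) t)) F"
    by (simp add: lborel_distr_plus)
  also have "\<dots> = emeasure lborel {y. y + t \<in> F}"
    using assms by (subst emeasure_distr) (auto simp: vimage_def add.commute)
  finally show ?thesis by simp
qed

lemma card_low_levels: "card {p\<in>{..<height n}. tower n ! p < real M} \<le> M * 3 ^ n"
proof -
  let ?Q = "{p\<in>{..<height n}. tower n ! p < real M}"
  have "(!) (tower n) ` ?Q \<subseteq> (\<lambda>m. real m * level_width n) ` {..<M * 3 ^ n}"
  proof
    fix x assume "x \<in> (!) (tower n) ` ?Q"
    then obtain p where p: "p < height n" "tower n ! p < real M" "x = tower n ! p" by auto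
    obtain m where m: "tower n ! p = real m * level_width n" by (rule tower_nth_triadic[OF p(1)])
    have "real m = tower n ! p * 3 ^ n" using m by (simp add: level_width_def)
    also have "\<dots> < real M * 3 ^ n" using p(2) by simp
    finally have "real m < real M * 3 ^ n" .
    then have "m < M * 3 ^ n" by (metis of_nat_less_iff of_nat_mult of_nat_numeral of_nat_power)
    then show "x \<in> (\<lambda>m. real m * level_width n) ` {..<M * 3 ^ n}" using m p by auto
  qed
  then have "card ((!) (tower n) ` ?Q) \<le> card ((\<lambda>m. real m * level_width n) ` {..<M * 3 ^ n})"
    by (intro card_mono) auto
  also have "\<dots> \<le> M * 3 ^ n" using card_image_le[of "{..<M * 3 ^ n}"] by simp
  also have "card ((!) (tower n) ` ?Q) = card ?Q"
    using distinct_tower by (intro card_image inj_on_nth) auto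
  finally show ?thesis .
qed

text \<open>Here \<open>E\<close> will be the symmetric difference of \<open>A\<close> and its approximation, and \<open>y\<close> a point of the bottom
  level: \<open>mismatch\<close> counts the errors met by \<open>y\<close> on its way up the column.\<close>

definition mismatch :: "nat \<Rightarrow> real set \<Rightarrow> real \<Rightarrow> nat" where
  "mismatch n E y = card {j\<in>{..<height n}. y + tower n ! j \<in> E}"

lemma mismatch_sum: "real (mismatch n E y) = (\<Sum>j<height n. indicator E (y + tower n ! j))"
  by (simp add: mismatch_def indicator_def Collect_conj_eq lessThan_def)

lemma mismatch_measurable [measurable]:
  assumes [measurable]: "E \<in> sets borel"
  shows "(\<lambda>y. real (mismatch n E y)) \<in> borel_measurable borel"
  unfolding mismatch_sum by measurable

text \<open>The restriction to a bounded interval is essential for small measure: the towers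
  have unbounded extent, and a bad column carries all of its levels with it.\<close>

definition misread :: "nat \<Rightarrow> real set \<Rightarrow> real \<Rightarrow> nat \<Rightarrow> real set" where
  "misread n E c M = {x \<in> {0..<real M}. \<exists>p<height n. x \<in> level n p \<and> c \<le> real (mismatch n E (x - tower n ! p))}"

lemma misread_measurable [measurable]:
  assumes [measurable]: "E \<in> sets borel"
  shows "misread n E c M \<in> sets borel"
proof -
  have [measurable]: "Measurable.pred borel (\<lambda>x. x \<in> level n p)" for p by simp
  have "misread n E c M = {x\<in>space borel. x \<in> {0..<real M} \<and> (\<exists>p\<in>{..<height n}. x \<in> level n p
      \<and> c \<le> real (mismatch n E (x - tower n ! p)))}"
    by (auto simp: misread_def)
  also have "\<dots> \<in> sets borel" by measurable
  finally show ?thesis .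
qed

text \<open>The total number of errors over the bottom level integrates to at most the measure of \<open>E\<close>, so Markov's
  inequality bounds the measure of the points \<open>Y\<close> of the bottom level with at least \<open>c\<close> errors.
  Only the \<open>M * 3 ^ n\<close> levels below \<open>M\<close> can contribute translates of \<open>Y\<close>.\<close>

lemma emeasure_misread_le:
  assumes [measurable]: "E \<in> sets borel" and "0 < c"
  shows "emeasure lborel (misread n E c M) \<le> ennreal (real M * 3 ^ n / c) * emeasure lborel E"
proof -
  let ?u = "\<lambda>y. ennreal (real (mismatch n E y))"
  let ?Q = "{p\<in>{..<height n}. tower n ! p < real M}"
  define Y where "Y = {y \<in> level n 0. 1 \<le> ennreal (1 / c) * ?u y}"
  have Y[measurable]: "Y \<in> sets borel" unfolding Y_def by measurable
  have markov: "emeasure lborel Y \<le> ennreal (1 / c) * (\<integral>\<^sup>+y. ?u y * indicator (level n 0) y \<partial>lborel)"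
    unfolding Y_def by (rule nn_integral_Markov_inequality) auto
  have "(\<integral>\<^sup>+y. ?u y * indicator (level n 0) y \<partial>lborel)
      = (\<integral>\<^sup>+y. (\<Sum>j<height n. indicator {y \<in> level n 0. y + tower n ! j \<in> E} y) \<partial>lborel)"
    by (intro nn_integral_cong) (auto simp: mismatch_sum indicator_def ennreal_of_nat_eq_real_of_nat)
  also have "\<dots> = (\<Sum>j<height n. emeasure lborel {y \<in> level n 0. y + tower n ! j \<in> E})"
    by (subst nn_integral_sum) auto
  also have "\<dots> = (\<Sum>j<height n. emeasure lborel (level n j \<inter> E))"
  proof (rule sum.cong)
    fix j
    have "{y \<in> level n 0. y + tower n ! j \<in> E} = {y. y + tower n ! j \<in> level n j \<inter> E}"
      by (auto simp: level_def tower_nth_0)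
    then show "emeasure lborel {y \<in> level n 0. y + tower n ! j \<in> E} = emeasure lborel (level n j \<inter> E)"
      using emeasure_lborel_shift[of "level n j \<inter> E" "tower n ! j"] by simp
  qed simp
  also have "\<dots> = emeasure lborel (\<Union>j<height n. level n j \<inter> E)"
    using level_disjoint by (intro sum_emeasure) (auto simp: disjoint_family_on_def)
  also have "\<dots> \<le> emeasure lborel E" by (intro emeasure_mono) auto
  finally have mY: "emeasure lborel Y \<le> ennreal (1 / c) * emeasure lborel E"
    by (intro order_trans[OF markov] mult_left_mono) simp_all
  have "misread n E c M \<subseteq> (\<Union>p\<in>?Q. {x. x + (- tower n ! p) \<in> Y})"
  proof
    fix x assume "x \<in> misread n E c M"
    then obtain p where p: "x < real M" "p < height n" "x \<in> level n p" "c \<le> real (mismatch n E (x - tower n ! p))"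
      by (auto simp: misread_def)
    have "1 \<le> ennreal (1 / c * real (mismatch n E (x - tower n ! p)))"
      using p(4) \<open>0 < c\<close> by (simp add: field_simps)
    also have "\<dots> = ennreal (1 / c) * ?u (x - tower n ! p)"
      using \<open>0 < c\<close> by (intro ennreal_mult) auto
    finally have "x - tower n ! p \<in> Y"
      using p(3) unfolding Y_def by (simp add: level_def tower_nth_0)
    moreover have "p \<in> ?Q" using p by (auto simp: level_def)
    ultimately show "x \<in> (\<Union>p\<in>?Q. {x. x + (- tower n ! p) \<in> Y})" by auto
  qed
  then have "emeasure lborel (misread n E c M) \<le> emeasure lborel (\<Union>p\<in>?Q. {x. x + (- tower n ! p) \<in> Y})"
    by (intro emeasure_mono) auto
  also have "\<dots> \<le> (\<Sum>p\<in>?Q. emeasure lborel {x. x + (- tower n ! p) \<in> Y})"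
    by (intro emeasure_subadditive_finite) auto
  also have "\<dots> = of_nat (card ?Q) * emeasure lborel Y"
    by (simp only: emeasure_lborel_shift[OF Y] sum_constant)
  also have "\<dots> \<le> of_nat (M * 3 ^ n) * (ennreal (1 / c) * emeasure lborel E)"
    using card_low_levels[of n M] mY by (intro mult_mono) (simp_all only: of_nat_le_iff zero_le)
  also have "\<dots> = ennreal (real M * 3 ^ n / c) * emeasure lborel E"
    using \<open>0 < c\<close> by (simp add: ennreal_of_nat_eq_real_of_nat[of "M * 3 ^ n"]
        mult.assoc[symmetric] ennreal_mult[symmetric] del: of_nat_mult of_nat_power) simp
  finally show ?thesis .
qed

section \<open>Standard Borel and almost-everywhere preliminaries\<close>

text \<open>The balls of radius \<open>1 / Suc n\<close> around the points of a countable dense set separate points.\<close>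

lemma standard_borel_separating:
  assumes "standard_borel M"
  obtains \<U> where "countable \<U>" "\<U> \<subseteq> sets M"
    "\<And>x y. x \<in> space M \<Longrightarrow> y \<in> space M \<Longrightarrow> x \<noteq> y
        \<Longrightarrow> \<exists>U\<in>\<U>. x \<in> U \<and> y \<notin> U"
proof -
  obtain \<tau> where \<tau>: "topspace \<tau> = space M" "completely_metrizable_space \<tau>" "separable_space \<tau>"
      "sets M = sigma_sets (space M) {U. openin \<tau> U}"
    using assms by (auto simp: standard_borel_def)
  obtain X d where "Metric_space X d" and \<tau>d: "\<tau> = Metric_space.mtopology X d"
    using \<tau>(2) by (auto simp: completely_metrizable_space_def)
  then interpret Metric_space X d by simp
  have X: "X = space M" using \<tau>(1) \<tau>d by simp
  obtain C where C: "countable C" "C \<subseteq> X" "mtopology closure_of C = X"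
    using \<tau>(3) \<tau>d by (auto simp: separable_space_def)
  let ?\<U> = "(\<lambda>(c, n). mball c (1 / real (Suc n))) ` (C \<times> UNIV)"
  have cnt: "countable ?\<U>" using C(1) by auto
  have meas: "?\<U> \<subseteq> sets M" using \<tau>(4) \<tau>d by auto
  have sep: "\<exists>U\<in>?\<U>. x \<in> U \<and> y \<notin> U" if xy: "x \<in> X" "y \<in> X" "x \<noteq> y" for x y
  proof -
    have "0 < d x y / 2" using mdist_pos_less[OF xy(3,1,2)] by (rule half_gt_zero)
    then obtain n where n: "1 / real (Suc n) < d x y / 2"
      by (rule nat_approx_posE)
    have "x \<in> mtopology closure_of C" using xy C(3) by simp
    moreover have "x \<in> mball x (1 / real (Suc n))" using xy by simp
    ultimately obtain c where c: "c \<in> C" "c \<in> mball x (1 / real (Suc n))"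
      unfolding in_closure_of using openin_mball by blast
    have "x \<in> mball c (1 / real (Suc n))" using c xy by (auto simp: commute)
    moreover have "y \<notin> mball c (1 / real (Suc n))"
    proof
      assume "y \<in> mball c (1 / real (Suc n))"
      then have "d c y < d x y / 2" "d x c < d x y / 2" using c n by auto
      then show False using triangle[of x c y] xy C(2) c(1) by auto
    qed
    ultimately show ?thesis using c(1) by auto
  qed
  show thesis
    by (rule that[OF cnt meas sep]) (simp_all add: X)
qed

lemma borel_chacon_space: "D \<in> sets chacon_space \<longleftrightarrow> D \<in> sets borel \<and> D \<subseteq> {0..}"
  unfolding chacon_space_def by (subst sets_restrict_space_iff) auto

lemma null_chacon_space: "N \<in> null_sets chacon_space \<longleftrightarrow> N \<in> null_sets lborel \<and> N \<subseteq> {0..}"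
  unfolding chacon_space_def by (subst null_sets_restrict_space) auto

lemma space_chacon_space [simp]: "space chacon_space = {0..}"
  by (simp add: chacon_space_def space_restrict_space)

lemma AE_chacon_space: "(AE x in chacon_space. P x) \<longleftrightarrow> (AE x in lborel. 0 \<le> x \<longrightarrow> P x)"
  unfolding chacon_space_def by (subst AE_restrict_space_iff) auto

lemma AE_lborel_shift:
  fixes P :: "real \<Rightarrow> bool"
  assumes "AE x in lborel. P x"
  shows "AE x in lborel. P (x + t)"
proof -
  have "AE x in distr lborel borel ((+) t). P x"
    by (subst lborel_distr_plus) (rule assms)
  then show ?thesis by (subst add.commute) (auto dest!: AE_distrD[rotated])
qed

text \<open>The points of a column are translates of each other by one of countably many numbers, and
  translations preserve null sets; so properties of almost every point may be used along whole columns.\<close>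

lemma AE_columns:
  assumes "AE x in chacon_space. P x"
  shows "AE x in chacon_space. \<forall>n. \<forall>p<height n. x \<in> level n p \<longrightarrow> (\<forall>j<height n. P (x - tower n ! p + tower n ! j))"
proof -
  have "AE x in lborel. 0 \<le> x + t \<longrightarrow> P (x + t)" for t
    using assms unfolding AE_chacon_space by (rule AE_lborel_shift)
  then have "AE x in lborel. \<forall>n p j. 0 \<le> x + (tower n ! j - tower n ! p) \<longrightarrow> P (x + (tower n ! j - tower n ! p))"
    by (simp add: AE_all_countable)
  then show ?thesis
    unfolding AE_chacon_space
  proof (rule AE_mp, intro AE_I2 impI allI)
    fix x n p j
    assume *: "\<forall>n p j. 0 \<le> x + (tower n ! j - tower n ! p) \<longrightarrow> P (x + (tower n ! j - tower n ! p))"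
      and "p < height n" "x \<in> level n p" "j < height n"
    then have "0 \<le> x + (tower n ! j - tower n ! p)"
      using tower_nth_nonneg[of j n] by (auto simp: level_def)
    with * have "P (x + (tower n ! j - tower n ! p))" by blast
    then show "P (x - tower n ! p + tower n ! j)" by (simp add: algebra_simps)
  qed
qed

section \<open>Reading the position off the name\<close>

lemma orbit_forward:
  assumes y: "y \<in> level n 0"
    and eq: "\<And>j. j < height n \<Longrightarrow> \<pi> (chacon (y + tower n ! j)) = R (\<pi> (y + tower n ! j))"
    and "q + j < height n"
  shows "(R ^^ j) (\<pi> (y + tower n ! q)) = \<pi> (y + tower n ! (q + j))"
  using assms(3)
proof (induction j)
  case (Suc j)
  then show ?case
    using eq[of "q + j"] chacon_step[of "q + j" n y] y by simp
qed simp

lemma orbit_backward: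
  assumes y: "y \<in> level n 0"
    and eq: "\<And>j. j < height n \<Longrightarrow> \<pi> (chacon (y + tower n ! j)) = R (\<pi> (y + tower n ! j))"
    and inv: "\<And>j. j < height n \<Longrightarrow> S (R (\<pi> (y + tower n ! j))) = \<pi> (y + tower n ! j)"
    and "q + j < height n"
  shows "(S ^^ j) (\<pi> (y + tower n ! (q + j))) = \<pi> (y + tower n ! q)"
  using assms(4)
proof (induction j)
  case (Suc j)
  have "\<pi> (y + tower n ! (q + Suc j)) = R (\<pi> (y + tower n ! (q + j)))"
    using eq[of "q + j"] chacon_step[of "q + j" n y] y Suc.prems by simp
  then show ?case
    using inv[of "q + j"] Suc by (simp add: funpow_Suc_right del: funpow.simps)
qed simp

definition close_name :: "nat \<Rightarrow> nat set \<Rightarrow> real \<Rightarrow> 'z set \<Rightarrow> ('z \<Rightarrow> 'z) \<Rightarrow> 'z \<Rightarrow> bool" where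
  "close_name n W e B R z \<longleftrightarrow>
     real (card {j\<in>{..<height n}. ((R ^^ j) z \<in> B) \<noteq> (j \<in> W)}) \<le> e"

lemma measurable_close_name:
  assumes [measurable]: "R \<in> \<rho> \<rightarrow>\<^sub>M \<rho>" "B \<in> sets \<rho>"
  shows "Measurable.pred \<rho> (close_name n W e B R)"
proof -
  have "real (card {j\<in>{..<height n}. ((R ^^ j) z \<in> B) \<noteq> (j \<in> W)})
      = (\<Sum>j<height n. of_bool (((R ^^ j) z \<in> B) \<noteq> (j \<in> W)))" for z
    by (simp add: Collect_conj_eq lessThan_def)
  then have "close_name n W e B R = (\<lambda>z. (\<Sum>j<height n. of_bool (((R ^^ j) z \<in> B) \<noteq> (j \<in> W))) \<le> e)"
    unfolding close_name_def by (intro ext) simp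
  also have "Measurable.pred \<rho> \<dots>"
    unfolding of_bool_def by measurable
  finally show ?thesis .
qed

text \<open>The descent by the true position \<open>p\<close> reaches the bottom of the column, from where the name is close to
  \<open>W\<close>.  A descent by \<open>q < p\<close> stops at height \<open>k = p - q\<close> in the same column.  As \<open>W\<close> occupies the lower half
  of the tower and \<open>k < body n\<close>, the translate of \<open>W\<close> by \<open>k\<close> still fits in the column, and a second close
  reading would make \<open>W\<close> too close to this translate.  Choosing the least candidate thus excludes every
  competitor without leaving the column.\<close>

lemma position_from_name:
  fixes \<pi> :: "real \<Rightarrow> 'z"
  assumes W: "W \<subseteq> {..<body n}"
    and sep: "\<And>k. 0 < k \<Longrightarrow> 2 * e < real (card (W - (+) k ` W))"
    and x: "x \<in> level (Suc n) p" and p: "p < body n"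
    and D: "\<And>j. j < height (Suc n) \<Longrightarrow> x - tower (Suc n) ! p + tower (Suc n) ! j \<in> D"
    and eq: "\<And>j. j < height (Suc n)
        \<Longrightarrow> \<pi> (chacon (x - tower (Suc n) ! p + tower (Suc n) ! j)) = R (\<pi> (x - tower (Suc n) ! p + tower (Suc n) ! j))"
    and inv: "\<And>j. j < height (Suc n)
        \<Longrightarrow> S (R (\<pi> (x - tower (Suc n) ! p + tower (Suc n) ! j))) = \<pi> (x - tower (Suc n) ! p + tower (Suc n) ! j)"
    and mis: "real (mismatch (Suc n) (sym_diff {u\<in>D. \<pi> u \<in> B} (level_union (Suc n) W)) (x - tower (Suc n) ! p)) \<le> e"
  shows "(LEAST q. close_name (Suc n) W e B R ((S ^^ q) (\<pi> x))) = p"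
proof -
  let ?t = "\<lambda>j. tower (Suc n) ! j" and ?h = "height (Suc n)"
  define y where "y = x - ?t p"
  have y: "y \<in> level (Suc n) 0" using x by (auto simp: y_def level_def tower_nth_0)
  have ph: "p < ?h" using p by (simp add: height_Suc)
  note fwd = orbit_forward[of y "Suc n" \<pi> R, OF y eq[folded y_def]]
  note bwd = orbit_backward[of y "Suc n" \<pi> R S, OF y eq[folded y_def] inv[folded y_def]]
  have Sq: "(S ^^ q) (\<pi> x) = \<pi> (y + ?t (p - q))" if "q \<le> p" for q
    using bwd[of "p - q" q] that ph by (simp add: y_def)
  have in_W: "y + ?t j \<in> level_union (Suc n) W \<longleftrightarrow> j \<in> W" if "j < ?h" for j
  proof -
    have "y + ?t j \<in> level (Suc n) j" using y by (auto simp: level_def tower_nth_0)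
    moreover have "i = j" if "i \<in> W" "y + ?t j \<in> level (Suc n) i" for i
      using level_disjoint[of i "Suc n" j] that \<open>j < ?h\<close> calculation W by (auto simp: height_Suc)
    ultimately show ?thesis unfolding level_union_def by blast
  qed
  let ?a = "\<lambda>j. \<pi> (y + ?t j) \<in> B"
  have "{j\<in>{..<?h}. ?a j \<noteq> (j \<in> W)} = {j\<in>{..<?h}. y + ?t j \<in> sym_diff {u\<in>D. \<pi> u \<in> B} (level_union (Suc n) W)}"
    using in_W D[folded y_def] by auto
  then have a: "real (card {j\<in>{..<?h}. ?a j \<noteq> (j \<in> W)}) \<le> e"
    using mis unfolding mismatch_def y_def by simp
  show ?thesis
  proof (rule Least_equality)
    have "(R ^^ j) ((S ^^ p) (\<pi> x)) = \<pi> (y + ?t j)" if "j < ?h" for j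
      using fwd[of 0 j] that Sq[of p] by simp
    then have "{j\<in>{..<?h}. ((R ^^ j) ((S ^^ p) (\<pi> x)) \<in> B) \<noteq> (j \<in> W)} = {j\<in>{..<?h}. ?a j \<noteq> (j \<in> W)}"
      by auto
    then show "close_name (Suc n) W e B R ((S ^^ p) (\<pi> x))"
      using a unfolding close_name_def by simp
    fix q assume q: "close_name (Suc n) W e B R ((S ^^ q) (\<pi> x))"
    show "p \<le> q"
    proof (rule ccontr)
      assume "\<not> p \<le> q"
      define k where "k = p - q"
      have k: "0 < k" "k \<le> p" "q \<le> p" using \<open>\<not> p \<le> q\<close> by (auto simp: k_def)
      let ?b = "\<lambda>j. (R ^^ j) ((S ^^ q) (\<pi> x)) \<in> B"
      have "card (W - (+) k ` W) \<le> card {j\<in>{..<?h}. ?a j \<noteq> (j \<in> W)} + card {j\<in>{..<?h}. ?b j \<noteq> (j \<in> W)}"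
      proof (rule card_diff_shift_le_mismatches)
        show "finite W" using W finite_subset by blast
        show "j + k < ?h" if "j \<in> W" for j
          using that W p k by (auto simp: height_Suc)
        show "?b j = ?a (j + k)" if "j + k < ?h" for j
          using fwd[of k j] Sq[OF k(3)] that by (simp add: k_def add.commute)
      qed
      then have "real (card (W - (+) k ` W)) \<le> 2 * e"
        using a q unfolding close_name_def by linarith
      then show False using sep[OF k(1)] by simp
    qed
  qed
qed

lemma position_exists:
  assumes "0 \<le> x" "x < real (height n) * level_width n"
  shows "\<exists>p<body n. x \<in> level (Suc n) p"
proof -
  have "x \<in> level_union (Suc n) (refine n {..<height n})"
    using assms unfolding Union_levels_refined[symmetric] by simp
  then obtain p where "p \<in> refine n {..<height n}" "x \<in> level (Suc n) p"
    by (auto simp: level_union_def)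
  then show ?thesis using refine_subset[of "{..<height n}" n] by auto
qed

lemma ex_finite_positive_set:
  assumes "sigma_finite_measure \<rho>" "emeasure \<rho> (space \<rho>) \<noteq> 0"
  obtains B where "B \<in> sets \<rho>" "0 < emeasure \<rho> B" "emeasure \<rho> B < \<infinity>"
proof -
  obtain A :: "nat \<Rightarrow> _" where A: "range A \<subseteq> sets \<rho>" "(\<Union>i. A i) = space \<rho>" "\<And>i. emeasure \<rho> (A i) \<noteq> \<infinity>"
    using sigma_finite_measure.sigma_finite[OF assms(1)] by blast
  have "\<exists>i. emeasure \<rho> (A i) \<noteq> 0"
  proof (rule ccontr)
    assume "\<not> ?thesis"
    then have "(\<Union>i. A i) \<in> null_sets \<rho>" using A(1) by (intro null_sets_UN) auto
    then show False using A(2) assms(2) by auto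
  qed
  then show thesis using A(1,3) that by (metis not_gr_zero range_subsetD top.not_eq_extremum infinity_ennreal_def)
qed

section \<open>The inverse map\<close>

text \<open>The map \<open>\<phi>\<close> is the limit of the left endpoints of the levels read off from the name of \<open>z\<close>.  Where no
  reading succeeds or the limit fails to exist its value is arbitrary; the maximum with \<open>0\<close> keeps it in
  the half-line.\<close>

lemma left_inverse_exists:
  fixes \<rho> :: "'z measure" and \<pi> :: "real \<Rightarrow> 'z"
  assumes sf: "sigma_finite_measure \<rho>" and R[measurable]: "R \<in> \<rho> \<rightarrow>\<^sub>M \<rho>"
    and S[measurable]: "S \<in> \<rho> \<rightarrow>\<^sub>M \<rho>" and SR: "AE z in \<rho>. S (R z) = z"
    and hom: "homomorphism chacon_space chacon \<rho> R D \<pi>"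
  shows "\<exists>\<phi> \<in> \<rho> \<rightarrow>\<^sub>M chacon_space. AE x in chacon_space. \<phi> (\<pi> x) = x"
proof -
  have D: "D \<in> sets chacon_space" "{0..} - D \<in> null_sets chacon_space"
    and \<pi>[measurable]: "\<pi> \<in> restrict_space chacon_space D \<rightarrow>\<^sub>M \<rho>"
    and \<pi>T: "AE x in chacon_space. \<pi> (chacon x) = R (\<pi> x)"
    and distr: "distr (restrict_space chacon_space D) \<rho> \<pi> = \<rho>"
    using hom by (auto simp: homomorphism_def)
  have Db: "D \<in> sets borel" "D \<subseteq> {0..}" using D(1) by (auto simp: borel_chacon_space)
  have sp: "space (restrict_space chacon_space D) = D"
    using Db(2) by (auto simp: space_restrict_space)
  have em: "emeasure \<rho> B = emeasure lborel {x\<in>D. \<pi> x \<in> B}" "{x\<in>D. \<pi> x \<in> B} \<in> sets borel" if "B \<in> sets \<rho>" for B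
  proof -
    have eq: "\<pi> -` B \<inter> space (restrict_space chacon_space D) = {x\<in>D. \<pi> x \<in> B}"
      using sp by auto
    have "{x\<in>D. \<pi> x \<in> B} \<in> sets (restrict_space chacon_space D)"
      unfolding eq[symmetric] using \<pi> that by (rule measurable_sets)
    then have "{x\<in>D. \<pi> x \<in> B} \<in> sets chacon_space"
      using D(1) by (subst (asm) sets_restrict_space_iff) (auto simp: borel_chacon_space)
    then show "{x\<in>D. \<pi> x \<in> B} \<in> sets borel" by (simp add: borel_chacon_space)
    have "emeasure \<rho> B = emeasure (distr (restrict_space chacon_space D) \<rho> \<pi>) B" by (simp add: distr)
    also have "\<dots> = emeasure (restrict_space chacon_space D) {x\<in>D. \<pi> x \<in> B}"
      using that by (subst emeasure_distr) (simp_all add: eq \<pi>)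
    also have "\<dots> = emeasure lborel {x\<in>D. \<pi> x \<in> B}"
      unfolding chacon_space_def using Db
      by (subst emeasure_restrict_space; (subst emeasure_restrict_space)?) (auto simp: sets_restrict_space_iff)
    finally show "emeasure \<rho> B = emeasure lborel {x\<in>D. \<pi> x \<in> B}" .
  qed
  have "emeasure \<rho> (space \<rho>) \<noteq> 0"
  proof
    assume "emeasure \<rho> (space \<rho>) = 0"
    moreover have "{x\<in>D. \<pi> x \<in> space \<rho>} = D" using measurable_space[OF \<pi>] sp by auto
    ultimately have "D \<in> null_sets lborel" using em[of "space \<rho>"] by auto
    moreover have "{0..} - D \<in> null_sets lborel" using D(2) by (simp add: null_chacon_space)
    ultimately have "D \<union> ({0..} - D) \<in> null_sets lborel" by (rule null_sets.Un)
    then have "{0..1::real} \<in> null_sets lborel" by (rule null_sets_subset) auto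
    then show False by auto
  qed
  with sf obtain B where B[measurable]: "B \<in> sets \<rho>" and B0: "0 < emeasure \<rho> B" "emeasure \<rho> B < \<infinity>"
    by (rule ex_finite_positive_set)
  define A where "A = {x\<in>D. \<pi> x \<in> B}"
  have A: "A \<in> sets borel" "A \<subseteq> {0..}" "0 < emeasure lborel A" "emeasure lborel A < \<infinity>"
    using em[OF B] B0 Db(2) by (auto simp: A_def)
  from approximating_words_separated[OF A] obtain \<eta> where \<eta>: "0 < \<eta>" and sep: "\<And>\<epsilon>. 0 < \<epsilon>
      \<Longrightarrow> eventually (\<lambda>n. \<exists>W\<subseteq>{..<body n}.
      measure lborel (sym_diff A (level_union (Suc n) W)) < \<epsilon>
      \<and> (\<forall>k>0. 2 * (\<eta> * 3 ^ Suc n) < real (card (W - (+) k ` W)))) sequentially"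
    by blast
  \<comment> \<open>The error allowed at step \<open>i\<close> makes the misread points of \<open>{0..<i}\<close>, whose measure is at most
      \<open>i / \<eta>\<close> times this error, a set of measure at most \<open>2 ^ -i\<close>.\<close>
  have "\<exists>n\<ge>i. \<exists>W\<subseteq>{..<body n}.
      measure lborel (sym_diff A (level_union (Suc n) W)) < \<eta> * (1 / 2) ^ i / (real i + 1)
      \<and> (\<forall>k>0. 2 * (\<eta> * 3 ^ Suc n) < real (card (W - (+) k ` W)))" for i
    using eventually_happens'[OF sequentially_bot eventually_conj[OF eventually_ge_at_top[of i] sep]] \<eta> by simp
  then obtain n W where n: "\<And>i. i \<le> n i" and W: "\<And>i. W i \<subseteq> {..<body (n i)}"
    and WA: "\<And>i. measure lborel (sym_diff A (level_union (Suc (n i)) (W i))) < \<eta> * (1 / 2) ^ i / (real i + 1)"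
    and Wk: "\<And>i k. 0 < k \<Longrightarrow> 2 * (\<eta> * 3 ^ Suc (n i)) < real (card (W i - (+) k ` W i))"
    by metis
  define e where "e i = \<eta> * 3 ^ Suc (n i)" for i
  define E where "E i = sym_diff A (level_union (Suc (n i)) (W i))" for i
  have E[measurable]: "E i \<in> sets borel" for i using A(1) by (simp add: E_def)
  define Q where "Q i z = (LEAST q. close_name (Suc (n i)) (W i) (e i) B R ((S ^^ q) z))" for i z
  define \<phi> where "\<phi> z = max 0 (lim (\<lambda>i. tower (Suc (n i)) ! Q i z))" for z
  have [measurable]: "Q i \<in> \<rho> \<rightarrow>\<^sub>M count_space UNIV" for i
    unfolding Q_def
  proof (rule measurable_Least)
    show "Measurable.pred \<rho> (\<lambda>z. close_name (Suc (n i)) (W i) (e i) B R ((S ^^ q) z))" for q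
      by (rule measurable_compose[OF _ measurable_close_name]) measurable
  qed
  have "\<phi> \<in> \<rho> \<rightarrow>\<^sub>M lborel" unfolding \<phi>_def by measurable
  then have \<phi>: "\<phi> \<in> \<rho> \<rightarrow>\<^sub>M chacon_space"
    unfolding chacon_space_def by (intro measurable_restrict_space2) (auto simp: \<phi>_def)
  have Am: "A \<in> fmeasurable lborel" using A by (simp add: fmeasurable_def)
  have Em: "E i \<in> fmeasurable lborel" for i
    unfolding E_def using Am level_union_fmeasurable[OF below_body_below_height[OF W[of i]]]
    by (intro fmeasurable.Un fmeasurable.Diff) auto
  have misread_le: "emeasure lborel (misread (Suc (n i)) (E i) (e i) i) \<le> ennreal ((1 / 2) ^ i)" for i
  proof -
    have "emeasure lborel (misread (Suc (n i)) (E i) (e i) i)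
        \<le> ennreal (real i * 3 ^ Suc (n i) / e i) * emeasure lborel (E i)"
      using \<eta> by (intro emeasure_misread_le) (auto simp: e_def)
    also have "\<dots> = ennreal (real i / \<eta> * measure lborel (E i))"
      using \<eta> by (simp add: emeasure_eq_measure2[OF Em] ennreal_mult[symmetric] e_def)
    also have "\<dots> \<le> ennreal ((1 / 2) ^ i)"
    proof (rule ennreal_leI)
      have "real i / \<eta> * measure lborel (E i) \<le> real i / \<eta> * (\<eta> * (1 / 2) ^ i / (real i + 1))"
        using WA[of i] \<eta> unfolding E_def by (intro mult_left_mono) auto
      also have "\<dots> = real i / (real i + 1) * (1 / 2) ^ i" using \<eta> by simp
      also have "\<dots> \<le> 1 * (1 / 2) ^ i" by (intro mult_right_mono) auto
      finally show "real i / \<eta> * measure lborel (E i) \<le> (1 / 2) ^ i" by simp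
    qed
    finally show ?thesis .
  qed
  have "AE x in lborel. eventually (\<lambda>i. x \<in> space lborel - misread (Suc (n i)) (E i) (e i) i) sequentially"
  proof (rule borel_cantelli_AE1)
    show "emeasure lborel (misread (Suc (n i)) (E i) (e i) i) < \<infinity>" for i
      using misread_le[of i] by (simp add: order_le_less_trans[OF _ ennreal_less_top])
    have "measure lborel (misread (Suc (n i)) (E i) (e i) i) \<le> (1 / 2) ^ i" for i
      using misread_le[of i] by (simp add: measure_def enn2real_leI)
    then show "summable (\<lambda>i. measure lborel (misread (Suc (n i)) (E i) (e i) i))"
      by (intro summable_comparison_test'[OF summable_geometric[of "1 / 2 :: real"]]) auto
  qed auto
  then have not_misread: "AE x in chacon_space. eventually (\<lambda>i. x \<notin> misread (Suc (n i)) (E i) (e i) i) sequentially"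
    unfolding AE_chacon_space by eventually_elim simp
  have inD: "AE x in chacon_space. x \<in> D"
    using D(2) by (rule AE_I') auto
  have "AE x in restrict_space chacon_space D. S (R (\<pi> x)) = \<pi> x"
    using SR by (subst (asm) distr[symmetric]) (rule AE_distrD[OF \<pi>])
  then have "AE x in chacon_space. x \<in> D \<longrightarrow> S (R (\<pi> x)) = \<pi> x"
    using D(1) by (subst (asm) AE_restrict_space_iff) (auto simp: borel_chacon_space)
  with inD \<pi>T have "AE x in chacon_space. x \<in> D \<and> \<pi> (chacon x) = R (\<pi> x) \<and> S (R (\<pi> x)) = \<pi> x"
    by eventually_elim auto
  from AE_columns[OF this] not_misread AE_space have "AE x in chacon_space. \<phi> (\<pi> x) = x"
  proof eventually_elim
    case (elim x)
    note columns = elim(1)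
    have x0: "0 \<le> x" using elim(3) by simp
    have lim_n: "filterlim n at_top sequentially"
      using n by (intro filterlim_at_top_mono[OF filterlim_ident]) auto
    have "eventually (\<lambda>i. x < real i) sequentially"
      using filterlim_real_sequentially by (auto simp: filterlim_at_top_dense)
    moreover have "eventually (\<lambda>i. x < real (height (n i)) * level_width (n i)) sequentially"
      using eventually_compose_filterlim[OF eventually_in_tower lim_n] .
    ultimately have near: "eventually (\<lambda>i. dist (tower (Suc (n i)) ! Q i (\<pi> x)) x \<le> level_width (Suc (n i))) sequentially"
      using elim(2)
    proof eventually_elim
      case (elim i)
      obtain p where p: "p < body (n i)" and xp: "x \<in> level (Suc (n i)) p"
        using position_exists[OF x0 elim(2)] by blast
      have ph: "p < height (Suc (n i))" using p by (simp add: height_Suc)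
      let ?y = "\<lambda>j. x - tower (Suc (n i)) ! p + tower (Suc (n i)) ! j"
      have col: "?y j \<in> D" "\<pi> (chacon (?y j)) = R (\<pi> (?y j))" "S (R (\<pi> (?y j))) = \<pi> (?y j)"
        if "j < height (Suc (n i))" for j
        using columns ph xp that by blast+
      have "real (mismatch (Suc (n i)) (E i) (x - tower (Suc (n i)) ! p)) \<le> e i"
        using elim(1,3) x0 ph xp unfolding misread_def by fastforce
      then have "Q i (\<pi> x) = p"
        unfolding Q_def using col Wk xp p W
        by (intro position_from_name[where D = D]) (auto simp: E_def A_def e_def)
      then show ?case using xp by (auto simp: level_def dist_real_def)
    qed
    have shrink: "(\<lambda>i. level_width (Suc (n i))) \<longlonglongrightarrow> 0"
      using filterlim_compose[OF LIMSEQ_Suc[OF level_width_tendsto] lim_n] .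
    have "dist (level_width m) 0 = level_width m" for m
      by (simp add: less_imp_le)
    with near have "eventually (\<lambda>i. dist (tower (Suc (n i)) ! Q i (\<pi> x)) x
        \<le> dist (level_width (Suc (n i))) 0) sequentially"
      by (simp only:)
    with shrink have "(\<lambda>i. tower (Suc (n i)) ! Q i (\<pi> x)) \<longlonglongrightarrow> x"
      by (rule metric_tendsto_imp_tendsto)
    then show "\<phi> (\<pi> x) = x" unfolding \<phi>_def using x0 by (simp add: limI)
  qed
  with \<phi> show ?thesis by blast
qed

theorem proposition4p6:
  fixes \<rho> :: "'z measure" and R :: "'z \<Rightarrow> 'z"
  assumes "factor_of \<rho> R chacon_space chacon"
  shows "\<forall>D \<pi>. homomorphism chacon_space chacon \<rho> R D \<pi>
           \<longrightarrow> isomorphism chacon_space chacon \<rho> R D \<pi>"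
proof (intro allI impI)
  fix D and \<pi> :: "real \<Rightarrow> 'z"
  assume hom: "homomorphism chacon_space chacon \<rho> R D \<pi>"
  have sb: "standard_borel \<rho>" and sf: "sigma_finite_measure \<rho>" and R: "R \<in> \<rho> \<rightarrow>\<^sub>M \<rho>"
    and "invertible_mod_null \<rho> R"
    using assms by (auto simp: factor_of_def dynamical_system_def measure_preserving_def)
  then obtain S where S: "S \<in> \<rho> \<rightarrow>\<^sub>M \<rho>" "AE z in \<rho>. S (R z) = z"
    by (auto simp: invertible_mod_null_def)
  obtain \<phi> where \<phi>[measurable]: "\<phi> \<in> \<rho> \<rightarrow>\<^sub>M chacon_space" and \<phi>\<pi>: "AE x in chacon_space. \<phi> (\<pi> x) = x"
    using left_inverse_exists[OF sf R S hom] by blast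
  have D[measurable]: "D \<in> sets chacon_space"
    and \<pi>: "\<pi> \<in> restrict_space chacon_space D \<rightarrow>\<^sub>M \<rho>"
    and distr: "distr (restrict_space chacon_space D) \<rho> \<pi> = \<rho>"
    using hom by (auto simp: homomorphism_def)
  have sub: "D \<subseteq> {0..}" using D by (simp add: borel_chacon_space)
  obtain \<U> where \<U>: "countable \<U>" "\<U> \<subseteq> sets \<rho>"
      "\<And>x y. x \<in> space \<rho> \<Longrightarrow> y \<in> space \<rho> \<Longrightarrow> x \<noteq> y
          \<Longrightarrow> \<exists>U\<in>\<U>. x \<in> U \<and> y \<notin> U"
    by (rule standard_borel_separating[OF sb]) (rule that)
  \<comment> \<open>By separation every point of \<open>G\<close> satisfies \<open>\<pi> (\<phi> z) = z\<close>; unlike that equation, the countably many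
      conditions defining \<open>G\<close> are measurable by construction.\<close>
  define G where "G = {z\<in>space \<rho>. \<phi> z \<in> D \<and> (\<forall>U\<in>\<U>. z \<in> U \<longleftrightarrow> \<phi> z \<in> {x\<in>D. \<pi> x \<in> U})}"
  have pre[measurable]: "{x\<in>D. \<pi> x \<in> U} \<in> sets chacon_space" if "U \<in> \<U>" for U
  proof -
    have "\<pi> -` U \<inter> space (restrict_space chacon_space D) \<in> sets (restrict_space chacon_space D)"
      using \<pi> that \<U>(2) by (intro measurable_sets) auto
    moreover have "\<pi> -` U \<inter> space (restrict_space chacon_space D) = {x\<in>D. \<pi> x \<in> U}"
      using sub by (auto simp: space_restrict_space)
    ultimately show ?thesis
      using D by (subst (asm) sets_restrict_space_iff) (auto simp: borel_chacon_space)
  qed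
  have [measurable]: "U \<in> sets \<rho>" if "U \<in> \<U>" for U using that \<U>(2) by auto
  have G: "{z\<in>space \<rho>. z \<in> G} \<in> sets \<rho>"
  proof -
    have "{z\<in>space \<rho>. z \<in> G} = {z\<in>space \<rho>. \<phi> z \<in> D \<and> (\<forall>U\<in>\<U>. z \<in> U \<longleftrightarrow> \<phi> z \<in> {x\<in>D. \<pi> x \<in> U})}"
      by (auto simp: G_def)
    also have "\<dots> \<in> sets \<rho>" using \<U>(1) by measurable
    finally show ?thesis .
  qed
  have "AE x in restrict_space chacon_space D. \<pi> x \<in> G"
  proof (subst AE_restrict_space_iff)
    show "D \<inter> space chacon_space \<in> sets chacon_space"
      using D by (simp add: sets.Int_space_eq2 del: space_chacon_space)
    show "AE x in chacon_space. x \<in> D \<longrightarrow> \<pi> x \<in> G"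
      using \<phi>\<pi>
    proof eventually_elim
      case (elim x)
      show ?case
      proof
        assume x: "x \<in> D"
        then have "\<pi> x \<in> space \<rho>"
          using measurable_space[OF \<pi>, of x] sub by (auto simp: space_restrict_space)
        with x elim show "\<pi> x \<in> G" by (auto simp: G_def)
      qed
    qed
  qed
  then have "AE z in \<rho>. z \<in> G"
    using AE_distr_iff[OF \<pi> G, unfolded distr] by blast
  then have "AE z in \<rho>. \<phi> z \<in> D \<and> \<pi> (\<phi> z) = z"
  proof eventually_elim
    case (elim z)
    then have z: "z \<in> space \<rho>" "\<phi> z \<in> D" "\<forall>U\<in>\<U>. z \<in> U \<longleftrightarrow> \<pi> (\<phi> z) \<in> U"
      by (auto simp: G_def)
    have "\<pi> (\<phi> z) \<in> space \<rho>"
      using measurable_space[OF \<pi>, of "\<phi> z"] z(2) sub by (auto simp: space_restrict_space)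
    then show ?case using \<U>(3)[of z "\<pi> (\<phi> z)"] z by metis
  qed
  with \<phi>\<pi> \<phi> hom show "isomorphism chacon_space chacon \<rho> R D \<pi>"
    unfolding isomorphism_def by blast
qed

end
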